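(* Let $\mu>-1$, $q>-1$ and $0<\gamma<1$. Then $$\lim_{x\downarrow0}R_{\mu,q,\gamma}(x)=\frac{2(\mu+1)}{q+1},\qquad \lim_{x\to\infty}R_{\mu,q,\gamma}(x)=\frac1{1-\gamma}.$$ Consequently, $$M^*_{\mu,q,\gamma}\ge\max\left\{\frac{2(\mu+1)}{q+1},\frac1{1-\gamma}\right\}.$$
   Context: $I_\alpha(x)=\sum_{k=0}^{\infty}\frac{(x/2)^{2k+\alpha}}{k!\,\Gamma(k+\alpha+1)}$, $x>0$, is the modified Bessel function of the first kind. For $x>0$, $$R_{\mu,q,\gamma}(x)=\frac{\int_0^x e^{-\gamma t}t^{q-\mu}I_\mu(t)\,dt}{e^{-\gamma x}x^{q-\mu}I_{\mu+1}(x)},\qquad M^*_{\mu,q,\gamma}=\sup_{x>0}R_{\mu,q,\gamma}(x).$$ *)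

theory Defs
  imports "HOL-Analysis.Analysis"
begin

text \<open>Only arguments x > 0 are meaningful: powr is the real power of a positive base.\<close>

definition bessel_I :: "real \<Rightarrow> real \<Rightarrow> real" where
  "bessel_I \<alpha> x =
     (\<Sum>k. (x / 2) powr (2 * real k + \<alpha>) / (fact k * Gamma (real k + \<alpha> + 1)))"

text \<open>The integrand is nonnegative for \<mu> > -1 but may be unbounded at 0 (it behaves like
  a multiple of t powr q there), so the integral is taken as a Lebesgue integral over the
  open interval.\<close>

definition bessel_ratio :: "real \<Rightarrow> real \<Rightarrow> real \<Rightarrow> real \<Rightarrow> real" where
  "bessel_ratio \<mu> q \<gamma> x =
     (LBINT t:{0<..<x}. exp (- \<gamma> * t) * t powr (q - \<mu>) * bessel_I \<mu> t) /
     (exp (- \<gamma> * x) * x powr (q - \<mu>) * bessel_I (\<mu> + 1) x)"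

text \<open>The supremum is taken in the extended reals, so that it denotes the least upper bound
  without presupposing that the ratio is bounded.\<close>

definition bessel_ratio_sup :: "real \<Rightarrow> real \<Rightarrow> real \<Rightarrow> ereal" where
  "bessel_ratio_sup \<mu> q \<gamma> = (SUP x\<in>{0<..}. ereal (bessel_ratio \<mu> q \<gamma> x))"

end

theory Submission
  imports Defs "HOL-Real_Asymp.Real_Asymp"
begin

text \<open>
  Write \<open>R = N / D\<close> for the ratio, with \<open>N\<close> the integral and \<open>D\<close> the denominator. Both limits
  come from l'Hopital's rule. By the fundamental theorem of calculus \<open>N' = f\<close>, the integrand,
  and the differential recurrences of \<open>I\<^sub>\<mu>\<close> give
    \<open>D' = f (1 + (q - 1 - 2\<mu> - \<gamma>x) \<rho>(x) / 2)\<close>,  where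
    \<open>\<rho>(x) = 2 I\<^bsub>\<mu>+1\<^esub>(x) / (x I\<^sub>\<mu>(x))\<close>.
  Hence everything reduces to the behaviour of \<open>\<rho>\<close>. At 0 the power series give
  \<open>\<rho> \<rightarrow> 1 / (\<mu> + 1)\<close>, so that \<open>D' / N' \<rightarrow> (q + 1) / (2 (\<mu> + 1))\<close>. At infinity the
  required fact is \<open>x \<rho>(x) \<rightarrow> 2\<close>, i.e. \<open>I\<^bsub>\<mu>+1\<^esub> / I\<^sub>\<mu> \<rightarrow> 1\<close>, which gives
  \<open>D' / N' \<rightarrow> 1 - \<gamma>\<close>.

  The limit of \<open>I\<^bsub>\<mu>+1\<^esub> / I\<^sub>\<mu>\<close> comes from log-concavity in the index: the Turan inequality
  \<open>I\<^sub>\<mu> I\<^bsub>\<mu>+2\<^esub> \<le> I\<^bsub>\<mu>+1\<^esub>\<^sup>2\<close> (lemma \<open>bessel_series_turan\<close>), combined with the three-term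
  recurrence, turns into a quadratic inequality for the quotient \<open>r\<^sub>\<mu> = I\<^bsub>\<mu>+1\<^esub> / I\<^sub>\<mu>\<close>, whence
  \<open>r\<^sub>\<mu>(x) \<ge> 1 - (\<mu> + 1) / x\<close>. The recurrence expresses \<open>r\<^sub>\<mu>\<close> as a decreasing function of
  \<open>r\<^bsub>\<mu>+1\<^esub>\<close>, so the lower bound at \<open>\<mu> + 1\<close> is an upper bound at \<open>\<mu>\<close>, and the two bounds
  squeeze \<open>r\<^sub>\<mu>\<close> to 1 (lemma \<open>bessel_quot_at_top\<close>).

  L'Hopital's rule at infinity also needs \<open>D \<rightarrow> \<infinity>\<close>. This follows because the logarithmic
  derivative of \<open>D\<close> tends to \<open>1 - \<gamma> > 0\<close>. Finally, a supremum over \<open>x > 0\<close> dominates every limit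
  taken within \<open>x > 0\<close>.
\<close>

section \<open>The entire part of the modified Bessel function\<close>

text \<open>
  This is \<open>I\<^sub>\<alpha>\<close> stripped of its factor \<open>(x / 2) powr \<alpha>\<close> and read as a function of
  \<open>y = x\<^sup>2 / 4\<close>: an entire function of \<open>y\<close>, the regularised hypergeometric function 0F1.
  The reciprocal Gamma function is entire, so the coefficients are meaningful for every real
  \<open>\<alpha>\<close>, and the functional equation of Gamma holds for them without exceptional points.
\<close>

definition bessel_series :: "real \<Rightarrow> real \<Rightarrow> real" where
  "bessel_series \<alpha> y = (\<Sum>k. rGamma (real k + \<alpha> + 1) / fact k * y ^ k)"

lemma summable_bessel_series:
  "summable (\<lambda>k. rGamma (real k + \<alpha> + 1) / fact k * y ^ k)"
proof (rule summable_ratio_test[of "1/2"])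
  define N where "N = nat \<lceil>max (2 * \<bar>y\<bar>) \<bar>\<alpha>\<bar>\<rceil>"
  show "norm (rGamma (real (Suc k) + \<alpha> + 1) / fact (Suc k) * y ^ Suc k)
          \<le> 1/2 * norm (rGamma (real k + \<alpha> + 1) / fact k * y ^ k)" if "k \<ge> N" for k
  proof -
    define z where "z = real k + \<alpha> + 1"
    (* Consecutive terms have ratio y / ((k + 1) * z), which is at most 1/2 from N onwards. *)
    have k: "real k \<ge> 2 * \<bar>y\<bar>" "real k \<ge> \<bar>\<alpha>\<bar>"
      using that unfolding N_def by linarith+
    then have z: "z \<ge> 1" unfolding z_def by linarith
    have step: "rGamma z = z * rGamma (z + 1)" by (simp add: rGamma_plus1)
    have arg: "real (Suc k) + \<alpha> + 1 = z + 1" by (simp add: z_def)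
    have "2 * \<bar>y\<bar> \<le> z * (1 + real k)"
      using mult_mono[of 1 z "2 * \<bar>y\<bar>" "1 + real k"] z k by simp
    then have "2 * \<bar>y\<bar> * (\<bar>rGamma (z + 1)\<bar> * \<bar>y\<bar> ^ k)
                 \<le> z * (1 + real k) * (\<bar>rGamma (z + 1)\<bar> * \<bar>y\<bar> ^ k)"
      by (intro mult_right_mono) auto
    then have "\<bar>rGamma (z + 1)\<bar> * \<bar>y\<bar> ^ Suc k / (1 + real k) \<le> 1/2 * (z * \<bar>rGamma (z + 1)\<bar> * \<bar>y\<bar> ^ k)"
      by (simp add: field_simps)
    then have "\<bar>rGamma (z + 1)\<bar> * \<bar>y\<bar> ^ Suc k / (1 + real k) / fact k
                 \<le> 1/2 * (z * \<bar>rGamma (z + 1)\<bar> * \<bar>y\<bar> ^ k) / fact k"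
      by (rule divide_right_mono) simp
    then show ?thesis
      unfolding arg z_def[symmetric] step using z
      by (simp add: abs_mult power_abs mult_ac)
  qed
qed simp

text \<open>
  Termwise differentiation shifts the coefficients by one index, and
  \<open>(k + 1) / fact (k + 1) = 1 / fact k\<close>. In terms of \<open>I\<^sub>\<alpha>\<close> this is the rule
  \<open>(x powr - \<alpha> * I\<^sub>\<alpha>(x))' = x powr - \<alpha> * I\<^bsub>\<alpha>+1\<^esub>(x)\<close>.
\<close>

lemma bessel_series_deriv:
  "(bessel_series \<alpha> has_real_derivative bessel_series (\<alpha> + 1) y) (at y)"
proof -
  have "diffs (\<lambda>k. rGamma (real k + \<alpha> + 1) / fact k)
          = (\<lambda>k. rGamma (real k + (\<alpha> + 1) + 1) / fact k)"
    by (rule ext) (simp add: diffs_def add_ac)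
  with termdiffs_strong_converges_everywhere[OF summable_bessel_series, of \<alpha> y]
  show ?thesis by (simp add: bessel_series_def[abs_def])
qed

text \<open>
  The recurrence \<open>I\<^sub>\<alpha> - I\<^bsub>\<alpha>+2\<^esub> = 2 (\<alpha> + 1) / x * I\<^bsub>\<alpha>+1\<^esub>\<close>. On coefficients it is
  \<open>rGamma z = z * rGamma (z + 1)\<close> at \<open>z = k + \<alpha> + 1\<close>, with \<open>z\<close> split into \<open>\<alpha> + 1\<close> and \<open>k\<close>; the
  factor \<open>k\<close> cancels against \<open>fact k\<close> and produces the shifted series.
\<close>

lemma bessel_series_recurrence:
  "bessel_series \<alpha> y = (\<alpha> + 1) * bessel_series (\<alpha> + 1) y + y * bessel_series (\<alpha> + 2) y"
proof -
  let ?c = "\<lambda>\<beta> k. rGamma (real k + \<beta> + 1) / fact k * y ^ k"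
  have shift: "(\<lambda>k. case k of 0 \<Rightarrow> 0 | Suc j \<Rightarrow> y * ?c (\<alpha> + 2) j) sums
                 (y * bessel_series (\<alpha> + 2) y)"
    using sums_Suc[of "\<lambda>k. case k of 0 \<Rightarrow> 0 | Suc j \<Rightarrow> y * ?c (\<alpha> + 2) j"]
      sums_mult[OF summable_sums[OF summable_bessel_series[of "\<alpha> + 2" y]], of y]
    by (simp add: bessel_series_def)
  have "(\<lambda>k. (\<alpha> + 1) * ?c (\<alpha> + 1) k + (case k of 0 \<Rightarrow> 0 | Suc j \<Rightarrow> y * ?c (\<alpha> + 2) j)) sums
          ((\<alpha> + 1) * bessel_series (\<alpha> + 1) y + y * bessel_series (\<alpha> + 2) y)"
    unfolding bessel_series_def[of "\<alpha> + 1"]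
    by (intro sums_add[OF _ shift] sums_mult summable_sums summable_bessel_series)
  moreover have "(\<alpha> + 1) * ?c (\<alpha> + 1) k + (case k of 0 \<Rightarrow> 0 | Suc j \<Rightarrow> y * ?c (\<alpha> + 2) j)
                   = ?c \<alpha> k" for k
  proof -
    have "rGamma (real k + \<alpha> + 1) = (real k + \<alpha> + 1) * rGamma (real k + (\<alpha> + 1) + 1)"
      using rGamma_plus1[of "real k + \<alpha> + 1"] by (simp add: add_ac)
    then have "?c \<alpha> k = (\<alpha> + 1) * ?c (\<alpha> + 1) k + real k * rGamma (real k + (\<alpha> + 1) + 1) / fact k * y ^ k"
      by (simp add: algebra_simps add_divide_distrib)
    moreover have "real k * rGamma (real k + (\<alpha> + 1) + 1) / fact k * y ^ k
        = (case k of 0 \<Rightarrow> 0 | Suc j \<Rightarrow> y * ?c (\<alpha> + 2) j)"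
      by (cases k) (simp_all add: add_ac)
    ultimately show ?thesis by simp
  qed
  ultimately show ?thesis
    by (simp add: bessel_series_def sums_iff)
qed

lemma bessel_series_pos:
  assumes "\<alpha> > -1" "y \<ge> 0"
  shows "bessel_series \<alpha> y > 0"
proof -
  have pos: "rGamma (real k + \<alpha> + 1) > 0" for k
    using assms by (simp add: rGamma_inverse_Gamma Gamma_real_pos)
  show ?thesis
    unfolding bessel_series_def
    by (rule suminf_pos2[OF summable_bessel_series, of _ _ 0])
       (use assms pos[of 0] less_imp_le[OF pos] in auto)
qed

lemma bessel_series_at_0: "bessel_series \<alpha> 0 = rGamma (\<alpha> + 1)"
  using powser_zero[of "\<lambda>k. rGamma (real k + \<alpha> + 1) / fact k"]
  by (simp add: bessel_series_def)

lemma continuous_bessel_series [continuous_intros]: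
  "continuous_on A f \<Longrightarrow> continuous_on A (\<lambda>x. bessel_series \<alpha> (f x))"
  using continuous_on_compose2[of UNIV "bessel_series \<alpha>" A f]
    DERIV_continuous_on[OF has_field_derivative_at_within[OF bessel_series_deriv]]
  by auto

lemma bessel_I_eq_series:
  assumes "x > 0"
  shows "bessel_I \<alpha> x = (x / 2) powr \<alpha> * bessel_series \<alpha> (x\<^sup>2 / 4)"
proof -
  have pow: "(x / 2) powr (2 * real k + \<alpha>) = (x / 2) powr \<alpha> * (x\<^sup>2 / 4) ^ k" for k
  proof -
    have "(x / 2) powr (2 * real k) = (x / 2) ^ (2 * k)"
      using assms powr_realpow[of "x / 2" "2 * k"] by simp
    then show ?thesis
      by (simp add: powr_add power_mult power_divide)
  qed
  have "(\<lambda>k. (x / 2) powr (2 * real k + \<alpha>) / (fact k * Gamma (real k + \<alpha> + 1)))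
     = (\<lambda>k. (x / 2) powr \<alpha> * (rGamma (real k + \<alpha> + 1) / fact k * (x\<^sup>2 / 4) ^ k))"
    unfolding pow by (simp add: rGamma_inverse_Gamma field_simps)
  then show ?thesis
    unfolding bessel_I_def bessel_series_def
    using suminf_mult[OF summable_bessel_series[of \<alpha> "x\<^sup>2 / 4"]] by simp
qed

section \<open>The Turan inequality and the quotient of consecutive Bessel functions\<close>

text \<open>
  Writing \<open>h\<^sub>j\<close> for the series with index \<open>\<alpha> + j\<close>, the two recurrences give
  \<open>(y powr (\<alpha> + 2) * (h\<^sub>1\<^sup>2 - h\<^sub>0 h\<^sub>2))' = y powr (\<alpha> + 1) * h\<^sub>1\<^sup>2 \<ge> 0\<close>, and the function being
  differentiated vanishes at 0 because \<open>\<alpha> + 2 > 0\<close>.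
\<close>

lemma bessel_series_turan:
  assumes \<alpha>: "\<alpha> > -1" and y: "y > 0"
  shows "bessel_series \<alpha> y * bessel_series (\<alpha> + 2) y \<le> (bessel_series (\<alpha> + 1) y)\<^sup>2"
proof -
  define W where "W = (\<lambda>y. y powr (\<alpha> + 2) *
    ((bessel_series (\<alpha> + 1) y)\<^sup>2 - bessel_series \<alpha> y * bessel_series (\<alpha> + 2) y))"
  have "W 0 \<le> W y"
  proof (rule DERIV_nonneg_imp_increasing_open[where f = W])
    show "\<exists>d. (W has_real_derivative d) (at t) \<and> 0 \<le> d" if "0 < t" "t < y" for t
    proof -
      let ?h = "\<lambda>j. bessel_series (\<alpha> + j) t"
      have rec: "?h 1 = (\<alpha> + 2) * ?h 2 + t * ?h 3" "bessel_series \<alpha> t = (\<alpha> + 1) * ?h 1 + t * ?h 2"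
        using bessel_series_recurrence[of "\<alpha> + 1" t] bessel_series_recurrence[of \<alpha> t]
        by (simp_all add: add_ac)
      have d: "(bessel_series (\<alpha> + 1) has_real_derivative ?h 2) (at t)"
        "(bessel_series (\<alpha> + 2) has_real_derivative ?h 3) (at t)"
        "(bessel_series \<alpha> has_real_derivative ?h 1) (at t)"
        using bessel_series_deriv[of "\<alpha> + 1" t] bessel_series_deriv[of "\<alpha> + 2" t]
          bessel_series_deriv[of \<alpha> t] by (simp_all add: add_ac)
      have tp: "t powr (\<alpha> + 2) = t powr (\<alpha> + 1) * t"
        using that powr_add[of t "\<alpha> + 1" 1] by (simp add: add_ac)
      have "(W has_real_derivative
          (\<alpha> + 2) * t powr (\<alpha> + 1) * ((?h 1)\<^sup>2 - bessel_series \<alpha> t * ?h 2)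
          + t powr (\<alpha> + 2) * (2 * ?h 1 * ?h 2 - (?h 1 * ?h 2 + bessel_series \<alpha> t * ?h 3))) (at t)"
        unfolding W_def using that
        by (auto intro!: derivative_eq_intros d simp: add.commute[of 1 \<alpha>] mult_ac)
      also have "(\<alpha> + 2) * t powr (\<alpha> + 1) * ((?h 1)\<^sup>2 - bessel_series \<alpha> t * ?h 2)
          + t powr (\<alpha> + 2) * (2 * ?h 1 * ?h 2 - (?h 1 * ?h 2 + bessel_series \<alpha> t * ?h 3))
          = t powr (\<alpha> + 1) * (?h 1)\<^sup>2"
      proof -
        have "(\<alpha> + 2) * ((?h 1)\<^sup>2 - bessel_series \<alpha> t * ?h 2)
            + t * (2 * ?h 1 * ?h 2 - (?h 1 * ?h 2 + bessel_series \<alpha> t * ?h 3)) = (?h 1)\<^sup>2"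
          using rec by algebra
        then show ?thesis unfolding tp by algebra
      qed
      finally show ?thesis by auto
    qed
    show "continuous_on {0..y} W"
      unfolding W_def using \<alpha> by (intro continuous_intros continuous_on_powr') auto
  qed (use y in simp)
  then have "0 \<le> y powr (\<alpha> + 2) *
    ((bessel_series (\<alpha> + 1) y)\<^sup>2 - bessel_series \<alpha> y * bessel_series (\<alpha> + 2) y)"
    by (simp add: W_def)
  then show ?thesis
    using y by (simp add: zero_le_mult_iff)
qed

text \<open>
  The quotient \<open>2 I\<^bsub>\<alpha>+1\<^esub>(x) / (x I\<^sub>\<alpha>(x))\<close>. The factor \<open>2 / x\<close> makes it continuous at 0.
\<close>

definition bessel_quot :: "real \<Rightarrow> real \<Rightarrow> real" where
  "bessel_quot \<alpha> x = bessel_series (\<alpha> + 1) (x\<^sup>2 / 4) / bessel_series \<alpha> (x\<^sup>2 / 4)"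

text \<open>
  Put \<open>r = x / 2 * bessel_quot \<alpha> x\<close> and \<open>d = (\<alpha> + 1) / x\<close>. The recurrence eliminates the series
  with index \<open>\<alpha> + 2\<close> from the Turan inequality, which becomes \<open>r\<^sup>2 + 2dr \<ge> 1\<close>, hence
  \<open>(r + d)\<^sup>2 \<ge> 1\<close>.
\<close>

lemma bessel_quot_lower:
  assumes \<alpha>: "\<alpha> > -1" and x: "x > 0"
  shows "x / 2 * bessel_quot \<alpha> x \<ge> 1 - (\<alpha> + 1) / x"
proof -
  define y where "y = x\<^sup>2 / 4"
  have y: "y > 0" using x by (simp add: y_def)
  define a b where "a = bessel_series \<alpha> y" and "b = bessel_series (\<alpha> + 1) y"
  have ab: "a > 0" "b > 0" unfolding a_def b_def using \<alpha> y by (auto intro!: bessel_series_pos)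
  define r where "r = x / 2 * (b / a)"
  have rpos: "r > 0" using ab x by (simp add: r_def)
  have "a * (y * bessel_series (\<alpha> + 2) y) \<le> y * b\<^sup>2"
    using mult_left_mono[OF bessel_series_turan[OF \<alpha> y], of y] y
    by (simp add: a_def b_def mult_ac)
  then have "a * (a - (\<alpha> + 1) * b) \<le> y * b\<^sup>2"
    using bessel_series_recurrence[of \<alpha> y] by (simp add: a_def b_def)
  then have "1 \<le> r\<^sup>2 + 2 * ((\<alpha> + 1) / x) * r"
  proof -
    have "r\<^sup>2 + 2 * ((\<alpha> + 1) / x) * r - 1 = (y * b\<^sup>2 - a * (a - (\<alpha> + 1) * b)) / a\<^sup>2"
      using ab x unfolding r_def y_def by (simp add: divide_simps) algebra
    with \<open>a * (a - (\<alpha> + 1) * b) \<le> y * b\<^sup>2\<close> have "r\<^sup>2 + 2 * ((\<alpha> + 1) / x) * r - 1 \<ge> 0"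
      by simp
    then show ?thesis by simp
  qed
  then have "1\<^sup>2 \<le> (r + (\<alpha> + 1) / x)\<^sup>2"
    using zero_le_power2[of "(\<alpha> + 1) / x"] unfolding power2_sum one_power2
      mult.assoc mult.commute[of r]
    by linarith
  then have "1 \<le> r + (\<alpha> + 1) / x"
    by (rule power2_le_imp_le) (use rpos \<alpha> x in auto)
  then show ?thesis
    by (simp add: bessel_quot_def r_def a_def b_def y_def)
qed

text \<open>
  With \<open>r\<close> and \<open>s\<close> the quotients \<open>x / 2 * bessel_quot\<close> at \<open>\<alpha>\<close> and \<open>\<alpha> + 1\<close>, the recurrence
  reads \<open>1 / r = s + 2 (\<alpha> + 1) / x\<close>. The lower bound \<open>s \<ge> 1 - (\<alpha> + 2) / x\<close> thus yields
  \<open>1 / r \<ge> 1 + \<alpha> / x\<close>.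
\<close>

lemma bessel_quot_upper:
  assumes \<alpha>: "\<alpha> > -1" and x: "x > 0" "x + \<alpha> > 0"
  shows "x / 2 * bessel_quot \<alpha> x \<le> x / (x + \<alpha>)"
proof -
  define a b c where "a = bessel_series \<alpha> (x\<^sup>2 / 4)" and "b = bessel_series (\<alpha> + 1) (x\<^sup>2 / 4)"
    and "c = bessel_series (\<alpha> + 2) (x\<^sup>2 / 4)"
  have ab: "a > 0" "b > 0" unfolding a_def b_def using \<alpha> by (auto intro!: bessel_series_pos)
  have "x / 2 * (c / b) \<ge> 1 - (\<alpha> + 2) / x"
    using bessel_quot_lower[of "\<alpha> + 1" x] \<alpha> x
    by (simp add: bessel_quot_def b_def c_def add_ac)
  then have "x\<^sup>2 / 2 * c \<ge> (x - (\<alpha> + 2)) * b"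
    using ab x by (simp add: field_simps power2_eq_square)
  moreover have "2 * a = 2 * (\<alpha> + 1) * b + x\<^sup>2 / 2 * c"
    using bessel_series_recurrence[of \<alpha> "x\<^sup>2 / 4"] by (simp add: a_def b_def c_def algebra_simps)
  ultimately have "(x + \<alpha>) * b \<le> 2 * a" by (simp add: algebra_simps)
  then have "x * ((x + \<alpha>) * b) \<le> x * (2 * a)" using x by (intro mult_left_mono) auto
  then have "x / 2 * (b / a) \<le> x / (x + \<alpha>)"
    using ab x by (simp add: field_simps)
  then show ?thesis by (simp add: bessel_quot_def a_def b_def)
qed

lemma bessel_quot_at_top:
  assumes \<alpha>: "\<alpha> > -1"
  shows "((\<lambda>x. x * bessel_quot \<alpha> x) \<longlongrightarrow> 2) at_top"
proof -
  have "((\<lambda>x. x / 2 * bessel_quot \<alpha> x) \<longlongrightarrow> 1) at_top"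
  proof (rule tendsto_sandwich)
    show "\<forall>\<^sub>F x in at_top. 1 - (\<alpha> + 1) / x \<le> x / 2 * bessel_quot \<alpha> x"
      using eventually_gt_at_top[of 0] by eventually_elim (rule bessel_quot_lower[OF \<alpha>])
    show "\<forall>\<^sub>F x in at_top. x / 2 * bessel_quot \<alpha> x \<le> x / (x + \<alpha>)"
      using eventually_gt_at_top[of 1]
      by eventually_elim (rule bessel_quot_upper, use \<alpha> in auto)
    show "((\<lambda>x. 1 - (\<alpha> + 1) / x) \<longlongrightarrow> 1) at_top" by real_asymp
    show "((\<lambda>x. x / (x + \<alpha>)) \<longlongrightarrow> 1) at_top" by real_asymp
  qed
  from tendsto_mult[OF tendsto_const[of 2] this] show ?thesis by simp
qed

lemma bessel_quot_at_0:
  assumes \<alpha>: "\<alpha> > -1"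
  shows "(bessel_quot \<alpha> \<longlongrightarrow> 1 / (\<alpha> + 1)) (at_right 0)"
proof -
  have "continuous_on UNIV (bessel_quot \<alpha>)"
    unfolding bessel_quot_def[abs_def]
    by (intro continuous_intros) (use \<alpha> bessel_series_pos in \<open>auto simp: less_imp_neq[symmetric]\<close>)
  then have "(bessel_quot \<alpha> \<longlongrightarrow> bessel_quot \<alpha> 0) (at 0)"
    by (simp add: continuous_on_def)
  moreover have "bessel_quot \<alpha> 0 = 1 / (\<alpha> + 1)"
  proof -
    have "rGamma (\<alpha> + 1) = (\<alpha> + 1) * rGamma (\<alpha> + 2)"
      using rGamma_plus1[of "\<alpha> + 1"] by (simp add: add_ac)
    moreover have "rGamma (\<alpha> + 2) > 0"
      using \<alpha> by (simp add: rGamma_inverse_Gamma Gamma_real_pos)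
    ultimately show ?thesis using \<alpha>
      by (simp add: bessel_quot_def bessel_series_at_0 add_ac)
  qed
  ultimately show ?thesis by (simp add: filterlim_at_split)
qed

section \<open>Primitives with an integrable singularity, and growth from logarithmic derivatives\<close>

text \<open>
  The Bessel integrand is \<open>t powr q\<close> times an entire function. The integrable weight makes the
  Lebesgue integral over the open interval agree with the gauge integral over the closed one,
  whose indefinite integral is continuous up to the endpoint 0 and differentiable wherever the
  integrand is continuous.
\<close>

lemma integral_powr_weight:
  fixes g :: "real \<Rightarrow> real"
  assumes q: "q > -1" and g: "continuous_on UNIV g"
  defines "N \<equiv> \<lambda>x. LBINT t:{0<..<x}. t powr q * g t"
  shows "(N \<longlongrightarrow> 0) (at_right 0)"
    and "x > 0 \<Longrightarrow> (N has_real_derivative x powr q * g x) (at x)"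
proof -
  let ?f = "\<lambda>t. t powr q * g t"
  have f_borel: "?f \<in> borel_measurable borel"
    using borel_measurable_continuous_onI[OF g] by measurable
  have f_abs: "?f absolutely_integrable_on {0..b}" if "b \<ge> 0" for b
  proof -
    have "(\<lambda>t. g t * t powr q) absolutely_integrable_on {0..b}"
    proof (rule absolutely_integrable_bounded_measurable_product_real)
      show "g \<in> borel_measurable (lebesgue_on {0..b})"
        using g by (intro continuous_imp_measurable_on_sets_lebesgue)
          (auto intro: continuous_on_subset)
      show "bounded (g ` {0..b})"
        using g by (intro compact_imp_bounded compact_continuous_image)
          (auto intro: continuous_on_subset)
      show "(\<lambda>t. t powr q) absolutely_integrable_on {0..b}"
        using q that by (intro nonnegative_absolutely_integrable_1 integrable_on_powr_from_0) auto
    qed simp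
    then show ?thesis by (simp add: mult.commute)
  qed
  have N_eq: "N x = integral {0..x} ?f" if "x \<ge> 0" for x
  proof -
    have "set_integrable lebesgue {0<..<x} ?f"
      by (rule set_integrable_subset[OF f_abs[OF that]]) auto
    then have "set_integrable lborel {0<..<x} ?f"
      unfolding set_integrable_def using f_borel
      by (subst (asm) integrable_completion) auto
    then show ?thesis
      unfolding N_def by (simp add: set_borel_integral_eq_integral(2) integral_open_interval_real)
  qed
  have f_int: "?f integrable_on {0..b}" if "b \<ge> 0" for b
    using f_abs[OF that] set_lebesgue_integral_eq_integral(1) by blast
  show "(N \<longlongrightarrow> 0) (at_right 0)"
  proof -
    have "continuous_on {0..1} (\<lambda>x. integral {0..x} ?f)"
      by (rule indefinite_integral_continuous_1[OF f_int]) simp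
    then have "((\<lambda>x. integral {0..x} ?f) \<longlongrightarrow> integral {0..0} ?f) (at_right 0)"
      by (rule continuous_on_Icc_at_rightD) simp
    then show ?thesis
      by (simp, elim Lim_transform_eventually) (auto simp: N_eq intro!: eventually_at_rightI[of 0 1])
  qed
  show "(N has_real_derivative x powr q * g x) (at x)" if x: "x > 0"
  proof -
    have "continuous (at x within {0..x + 1} - {}) ?f"
    proof -
      have "isCont g x" using g by (simp add: continuous_on_eq_continuous_at)
      then have "isCont ?f x" using x by (intro continuous_intros) auto
      then show ?thesis by (rule continuous_at_imp_continuous_at_within)
    qed
    with integral_has_vector_derivative_continuous_at[of ?f 0 "x + 1" x "{}"] f_int[of "x + 1"] x
    have "((\<lambda>u. integral {0..u} ?f) has_vector_derivative ?f x) (at x within {0..x + 1})"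
      by simp
    then have "((\<lambda>u. integral {0..u} ?f) has_real_derivative ?f x) (at x)"
      using x at_within_Icc_at[of 0 x "x + 1"]
      by (simp add: has_real_derivative_iff_has_vector_derivative)
    then show ?thesis
      by (rule has_field_derivative_transform_within[of _ _ _ _ x])
         (use x in \<open>auto simp: N_eq dist_real_def\<close>)
  qed
qed

text \<open>
  By l'Hopital's rule \<open>ln (D x) / x\<close> has the same limit \<open>c > 0\<close> as \<open>D' / D\<close>, so \<open>D\<close> grows
  exponentially.
\<close>

lemma at_top_if_log_deriv_tendsto_pos:
  fixes D D' :: "real \<Rightarrow> real"
  assumes pos: "\<And>x. x > 0 \<Longrightarrow> D x > 0"
    and deriv: "\<And>x. x > 0 \<Longrightarrow> (D has_real_derivative D' x) (at x)"
    and lim: "((\<lambda>x. D' x / D x) \<longlongrightarrow> c) at_top" and c: "c > 0"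
  shows "filterlim D at_top at_top"
proof -
  have "((\<lambda>x. ln (D x) / x) \<longlongrightarrow> c) at_top"
  proof (rule lhospital_at_top_at_top)
    show "\<forall>\<^sub>F x in at_top. ((\<lambda>x. ln (D x)) has_real_derivative D' x / D x) (at x)"
      using eventually_gt_at_top[of 0]
      by eventually_elim (auto intro!: derivative_eq_intros deriv simp: pos)
    show "\<forall>\<^sub>F x in at_top. ((\<lambda>x. x) has_real_derivative 1) (at x)"
      by (auto intro!: derivative_eq_intros)
  qed (use lim in \<open>auto intro: filterlim_ident\<close>)
  then have "filterlim (\<lambda>x. ln (D x) / x * x) at_top at_top"
    using c by (rule filterlim_tendsto_pos_mult_at_top) (rule filterlim_ident)
  then have "filterlim (\<lambda>x. exp (ln (D x) / x * x)) at_top at_top"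
    by (rule filterlim_compose[OF exp_at_top])
  then show ?thesis
  proof (rule filterlim_mono_eventually)
    show "\<forall>\<^sub>F x in at_top. exp (ln (D x) / x * x) = D x"
      using eventually_gt_at_top[of 0] by eventually_elim (simp add: pos)
  qed auto
qed

section \<open>Limits of the ratio\<close>

theorem proposition6p1:
  fixes \<mu> q \<gamma> :: real
  assumes "\<mu> > -1" and "q > -1" and "0 < \<gamma>" and "\<gamma> < 1"
  shows "(bessel_ratio \<mu> q \<gamma> \<longlongrightarrow> 2 * (\<mu> + 1) / (q + 1)) (at_right 0) \<and>
         (bessel_ratio \<mu> q \<gamma> \<longlongrightarrow> 1 / (1 - \<gamma>)) at_top \<and>
         bessel_ratio_sup \<mu> q \<gamma> \<ge> ereal (max (2 * (\<mu> + 1) / (q + 1)) (1 / (1 - \<gamma>)))"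
proof -
  note \<mu> = assms(1) and q = assms(2) and \<gamma> = assms(3,4)
  let ?h = "\<lambda>j x. bessel_series (\<mu> + j) (x\<^sup>2 / 4)"
  let ?\<rho> = "bessel_quot \<mu>"
  define g where "g = (\<lambda>t. exp (- \<gamma> * t) * 2 powr (- \<mu>) * ?h 0 t)"
  define f where "f = (\<lambda>t. t powr q * g t)"
  define N where "N = (\<lambda>x. LBINT t:{0<..<x}. f t)"
  define D where "D = (\<lambda>x. exp (- \<gamma> * x) * 2 powr (- \<mu>) / 2 * x powr (q + 1) * ?h 1 x)"
  define E where "E = (\<lambda>x. 1 + (q - 1 - 2 * \<mu> - \<gamma> * x) * ?\<rho> x / 2)"
  have h_pos: "?h 0 x > 0" "?h 1 x > 0" for x
    using \<mu> by (auto intro!: bessel_series_pos)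
  have f_pos: "f x > 0" and D_pos: "D x > 0" if "x > 0" for x
    using that h_pos unfolding f_def g_def D_def by simp_all
  have ratio: "bessel_ratio \<mu> q \<gamma> x = N x / D x" if "x > 0" for x
  proof -
    have "(LBINT t:{0<..<x}. exp (- \<gamma> * t) * t powr (q - \<mu>) * bessel_I \<mu> t) = N x"
      unfolding N_def
    proof (rule set_lebesgue_integral_cong)
      show "\<forall>t. t \<in> {0<..<x} \<longrightarrow>
              exp (- \<gamma> * t) * t powr (q - \<mu>) * bessel_I \<mu> t = f t"
        by (auto simp: f_def g_def bessel_I_eq_series powr_divide powr_diff powr_minus field_simps)
    qed simp
    moreover have "exp (- \<gamma> * x) * x powr (q - \<mu>) * bessel_I (\<mu> + 1) x = D x"
      using that by (simp add: D_def bessel_I_eq_series powr_divide powr_diff powr_minus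
          powr_add field_simps)
    ultimately show ?thesis by (simp add: bessel_ratio_def)
  qed
  have g_cont: "continuous_on UNIV g"
    unfolding g_def by (intro continuous_intros) auto
  have N_0: "(N \<longlongrightarrow> 0) (at_right 0)"
    and N_deriv: "\<And>x. x > 0 \<Longrightarrow> (N has_real_derivative f x) (at x)"
    using integral_powr_weight[OF q g_cont] unfolding N_def f_def by auto
  have D_deriv: "(D has_real_derivative f x * E x) (at x)" if x: "x > 0" for x
  proof -
    have d: "((\<lambda>x. ?h 1 x) has_real_derivative ?h 2 x * (x / 2)) (at x)"
      by (rule DERIV_chain2[of "bessel_series (\<mu> + 1)"])
         (use bessel_series_deriv[of "\<mu> + 1" "x\<^sup>2 / 4"] in
           \<open>auto intro!: derivative_eq_intros simp: add_ac\<close>)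
    have rec: "?h 0 x = (\<mu> + 1) * ?h 1 x + x\<^sup>2 / 4 * ?h 2 x"
      using bessel_series_recurrence[of \<mu> "x\<^sup>2 / 4"] by simp
    have xp: "x powr (q + 1) = x * x powr q" using x by (simp add: powr_add)
    let ?K = "exp (- \<gamma> * x) * 2 powr (- \<mu>)"
    have "(D has_real_derivative
        ?K / 2 * ((q + 1) * x powr q - \<gamma> * x powr (q + 1)) * ?h 1 x
          + ?K / 2 * x powr (q + 1) * (?h 2 x * (x / 2))) (at x)"
      unfolding D_def using x
      by (auto intro!: derivative_eq_intros d simp del: mult_minus_left) (simp add: algebra_simps)
    also have "?K / 2 * ((q + 1) * x powr q - \<gamma> * x powr (q + 1)) * ?h 1 x
          + ?K / 2 * x powr (q + 1) * (?h 2 x * (x / 2))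
        = ?K / 2 * x powr q * ((q + 1 - \<gamma> * x) * ?h 1 x + x\<^sup>2 / 2 * ?h 2 x)"
      unfolding xp by (simp add: algebra_simps power2_eq_square)
    also have "?K / 2 * x powr q * ((q + 1 - \<gamma> * x) * ?h 1 x + x\<^sup>2 / 2 * ?h 2 x)
        = ?K * x powr q * (?h 0 x + (q - 1 - 2 * \<mu> - \<gamma> * x) * ?h 1 x / 2)"
      unfolding rec by (simp add: field_simps)
    also have "\<dots> = f x * E x"
      using h_pos[of x] by (simp add: f_def g_def E_def bessel_quot_def field_simps)
    finally show ?thesis .
  qed
  have fE: "f x / (f x * E x) = 1 / E x" if "x > 0" for x
    using f_pos[OF that] by simp

  (* Since N' = f and D' = f * E, both limits of the ratio are limits of 1 / E. *)
  have lim_0: "(bessel_ratio \<mu> q \<gamma> \<longlongrightarrow> 2 * (\<mu> + 1) / (q + 1)) (at_right 0)"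
  proof -
    have "(E \<longlongrightarrow> 1 + (q - 1 - 2 * \<mu> - \<gamma> * 0) * (1 / (\<mu> + 1)) / 2) (at_right 0)"
      unfolding E_def by (intro tendsto_intros bessel_quot_at_0[OF \<mu>]) auto
    also have "1 + (q - 1 - 2 * \<mu> - \<gamma> * 0) * (1 / (\<mu> + 1)) / 2 = (q + 1) / (2 * (\<mu> + 1))"
      using \<mu> by (simp add: field_simps)
    finally have E: "(E \<longlongrightarrow> (q + 1) / (2 * (\<mu> + 1))) (at_right 0)" .
    have E_pos: "\<forall>\<^sub>F x in at_right 0. E x > 0"
      by (rule order_tendstoD(1)[OF E]) (use \<mu> q in auto)
    have gt0: "\<forall>\<^sub>F x in at_right 0. x > (0::real)" by (rule eventually_at_right_less)
    have "((\<lambda>x. N x / D x) \<longlongrightarrow> 2 * (\<mu> + 1) / (q + 1)) (at_right 0)"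
    proof (rule lhopital_right_0[OF N_0])
      have "continuous_on {0..1} D"
        unfolding D_def using q by (intro continuous_intros continuous_on_powr') auto
      then have "(D \<longlongrightarrow> D 0) (at_right 0)" by (simp add: continuous_on_Icc_at_rightD)
      then show "(D \<longlongrightarrow> 0) (at_right 0)" by (simp add: D_def)
      show "\<forall>\<^sub>F x in at_right 0. D x \<noteq> 0"
        using gt0 by eventually_elim (use D_pos in force)
      show "\<forall>\<^sub>F x in at_right 0. f x * E x \<noteq> 0"
        using gt0 E_pos by eventually_elim (use f_pos in force)
      show "\<forall>\<^sub>F x in at_right 0. (N has_real_derivative f x) (at x)"
        using gt0 by eventually_elim (rule N_deriv)
      show "\<forall>\<^sub>F x in at_right 0. (D has_real_derivative f x * E x) (at x)"
        using gt0 by eventually_elim (rule D_deriv)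
      have "((\<lambda>x. 1 / E x) \<longlongrightarrow> 1 / ((q + 1) / (2 * (\<mu> + 1)))) (at_right 0)"
        by (intro tendsto_intros E) (use \<mu> q in auto)
      then have "((\<lambda>x. 1 / E x) \<longlongrightarrow> 2 * (\<mu> + 1) / (q + 1)) (at_right 0)"
        by simp
      then show "((\<lambda>x. f x / (f x * E x)) \<longlongrightarrow> 2 * (\<mu> + 1) / (q + 1)) (at_right 0)"
        by (rule Lim_transform_eventually) (use gt0 in eventually_elim, rule fE[symmetric])
    qed
    then show ?thesis
      by (rule Lim_transform_eventually) (use gt0 in eventually_elim, simp add: ratio)
  qed

  have lim_top: "(bessel_ratio \<mu> q \<gamma> \<longlongrightarrow> 1 / (1 - \<gamma>)) at_top"
  proof -
    have gt0: "\<forall>\<^sub>F x in at_top. x > (0::real)" by (rule eventually_gt_at_top)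
    note x\<rho> = bessel_quot_at_top[OF \<mu>]
    have "((\<lambda>x. 1 + ((q - 1 - 2 * \<mu>) / x - \<gamma>) * (x * ?\<rho> x) / 2) \<longlongrightarrow> 1 + (0 - \<gamma>) * 2 / 2) at_top"
    proof -
      have "((\<lambda>x. (q - 1 - 2 * \<mu>) / x) \<longlongrightarrow> 0) at_top" by real_asymp
      then show ?thesis by (intro tendsto_intros x\<rho>) auto
    qed
    then have "((\<lambda>x. 1 + ((q - 1 - 2 * \<mu>) / x - \<gamma>) * (x * ?\<rho> x) / 2) \<longlongrightarrow> 1 - \<gamma>) at_top"
      by simp
    then have E: "(E \<longlongrightarrow> 1 - \<gamma>) at_top"
      by (rule Lim_transform_eventually)
         (use gt0 in eventually_elim, simp add: E_def field_simps)
    have E_pos: "\<forall>\<^sub>F x in at_top. E x > 0"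
      by (rule order_tendstoD(1)[OF E]) (use \<gamma> in auto)
    have "filterlim D at_top at_top"
    proof (rule at_top_if_log_deriv_tendsto_pos)
      show "D x > 0" "(D has_real_derivative f x * E x) (at x)" if "x > 0" for x
        using D_pos D_deriv that by blast+
      (* D = f * x * \<rho> / 2, so the logarithmic derivative f * E / D depends on E and \<rho> alone. *)
      have "((\<lambda>x. 2 * E x / (x * ?\<rho> x)) \<longlongrightarrow> 2 * (1 - \<gamma>) / 2) at_top"
        by (intro tendsto_intros E x\<rho>) auto
      then have "((\<lambda>x. 2 * E x / (x * ?\<rho> x)) \<longlongrightarrow> 1 - \<gamma>) at_top"
        by (simp only: nonzero_mult_div_cancel_left[OF zero_neq_numeral[symmetric]])
      then show "((\<lambda>x. f x * E x / D x) \<longlongrightarrow> 1 - \<gamma>) at_top"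
      proof (rule Lim_transform_eventually)
        show "\<forall>\<^sub>F x in at_top. 2 * E x / (x * ?\<rho> x) = f x * E x / D x"
          using gt0
        proof eventually_elim
          case (elim x)
          then have D_eq: "D x = f x * (x * ?\<rho> x) / 2"
            using h_pos[of x] by (simp add: f_def g_def D_def bessel_quot_def powr_add)
          show ?case unfolding D_eq using f_pos[OF elim] by simp
        qed
      qed
      show "1 - \<gamma> > 0" using \<gamma> by simp
    qed
    then have "((\<lambda>x. N x / D x) \<longlongrightarrow> 1 / (1 - \<gamma>)) at_top"
    proof (rule lhospital_at_top_at_top)
      show "\<forall>\<^sub>F x in at_top. f x * E x \<noteq> 0"
        using gt0 E_pos by eventually_elim (use f_pos in force)
      show "\<forall>\<^sub>F x in at_top. (N has_real_derivative f x) (at x)"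
        using gt0 by eventually_elim (rule N_deriv)
      show "\<forall>\<^sub>F x in at_top. (D has_real_derivative f x * E x) (at x)"
        using gt0 by eventually_elim (rule D_deriv)
      have "((\<lambda>x. 1 / E x) \<longlongrightarrow> 1 / (1 - \<gamma>)) at_top"
        by (intro tendsto_intros E) (use \<gamma> in auto)
      then show "((\<lambda>x. f x / (f x * E x)) \<longlongrightarrow> 1 / (1 - \<gamma>)) at_top"
        by (rule Lim_transform_eventually) (use gt0 in eventually_elim, rule fE[symmetric])
    qed
    then show ?thesis
      by (rule Lim_transform_eventually) (use gt0 in eventually_elim, simp add: ratio)
  qed

  have le_sup: "ereal L \<le> bessel_ratio_sup \<mu> q \<gamma>"
    if lim: "(bessel_ratio \<mu> q \<gamma> \<longlongrightarrow> L) F" and F: "F \<noteq> bot" "\<forall>\<^sub>F x in F. x > 0"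
    for L and F :: "real filter"
  proof (rule tendsto_upperbound[OF _ _ F(1)])
    show "((\<lambda>x. ereal (bessel_ratio \<mu> q \<gamma> x)) \<longlongrightarrow> ereal L) F"
      using lim by simp
    show "\<forall>\<^sub>F x in F. ereal (bessel_ratio \<mu> q \<gamma> x) \<le> bessel_ratio_sup \<mu> q \<gamma>"
      using F(2) by eventually_elim (auto simp: bessel_ratio_sup_def intro: SUP_upper)
  qed
  have "ereal (max (2 * (\<mu> + 1) / (q + 1)) (1 / (1 - \<gamma>))) \<le> bessel_ratio_sup \<mu> q \<gamma>"
    using le_sup[OF lim_0 _ eventually_at_right_less] le_sup[OF lim_top _ eventually_gt_at_top]
    by (simp add: max_def)
  with lim_0 lim_top show ?thesis by blast
qed

end
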